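(* Let $k$ be a positive integer and $n\ge 0$ an integer. Let $M_n^{(k)}$, $J_n^{(k)}$ and $j_n^{(k)}$ be the $n$th higher order Mersenne, Jacobsthal and Jacobsthal-Lucas numbers, respectively. Then: 1. If $n$ is even, then $M_n^{(k)}=J_n^{(k)}$ if $k$ is even, and $M_n^{(k)}=\left(\frac{2^k+1}{2^k-1}\right)J_n^{(k)}$ if $k$ is odd. 2. If $n$ is odd, then $M_n^{(k)}=J_n^{(k)}$ if $k$ is even, and $M_n^{(k)}=j_n^{(k)}$ if $k$ is odd. 3. $M_n^{(2k)}=J_n^{(k)}j_n^{(k)}$.
   Context: The Mersenne numbers $\{M_n\}_{n\ge 0}$ are defined by $M_0=0$, $M_1=1$, $M_{n+2}=3M_{n+1}-2M_n$, i.e. $M_n=2^n-1$. For a positive integer $k$, the higher order Mersenne numbers are $M_n^{(k)}=M_{kn}/M_k$ for $n=0,1,2,\dots$. The higher order Jacobsthal numbers and higher order Jacobsthal-Lucas numbers are given (for positive integers $k$ and $n\ge 0$) by $$J_n^{(k)}=\frac{(2^k)^n-\left((-1)^k\right)^n}{2^k-(-1)^k},\qquad j_n^{(k)}=\frac{(2^k)^n+\left((-1)^k\right)^n}{2^k+(-1)^k}.$$ *)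

theory Defs
  imports Complex_Main
begin

fun mersenne :: "nat \<Rightarrow> int" where
  "mersenne 0 = 0"
| "mersenne (Suc 0) = 1"
| "mersenne (Suc (Suc n)) = 3 * mersenne (Suc n) - 2 * mersenne n"

text \<open>The higher order numbers are quotients and are taken in the rationals; in general the
  Jacobsthal-Lucas quotient is not an integer. The order \<open>k\<close> is meant to be positive.\<close>

definition ho_mersenne :: "nat \<Rightarrow> nat \<Rightarrow> rat" where
  "ho_mersenne k n = of_int (mersenne (k * n)) / of_int (mersenne k)"

definition ho_jacobsthal :: "nat \<Rightarrow> nat \<Rightarrow> rat" where
  "ho_jacobsthal k n = ((2 ^ k) ^ n - ((-1) ^ k) ^ n) / (2 ^ k - (-1) ^ k)"

definition ho_jacobsthal_lucas :: "nat \<Rightarrow> nat \<Rightarrow> rat" where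
  "ho_jacobsthal_lucas k n = ((2 ^ k) ^ n + ((-1) ^ k) ^ n) / (2 ^ k + (-1) ^ k)"

end

theory Submission
  imports Defs
begin

text \<open>By \<open>mersenne_eq\<close>, the higher order Mersenne number is ((2^k)^n - 1) / (2^k
  - 1). The other two quotients differ from it only in signs (-1)^k and (-1)^(k n), so fixing the
  parities of k and n settles the first two claims. The product formula is a difference of squares
  (\<open>ho_mersenne_double\<close>).\<close>

lemma mersenne_eq: "mersenne n = 2 ^ n - 1"
  by (induction n rule: mersenne.induct) auto

lemma ho_mersenne_eq: "ho_mersenne k n = ((2 ^ k) ^ n - 1) / (2 ^ k - 1)"
  by (simp add: ho_mersenne_def mersenne_eq power_mult)

text \<open>Numerators and denominators each multiply as (a - b)(a + b); the sign terms square to 1,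
  and squaring 2^k doubles the order.\<close>

lemma ho_mersenne_double:
  "ho_mersenne (2 * k) n = ho_jacobsthal k n * ho_jacobsthal_lucas k n"
proof -
  have diff_squares: "(x - y) / (u - v) * ((x + y) / (u + v)) = (x\<^sup>2 - y\<^sup>2) / (u\<^sup>2 - v\<^sup>2)"
    for x y u v :: rat
    by (simp add: power2_eq_square square_diff_square_factored mult.commute)
  have square_sign: "(((-1) ^ k) ^ n)\<^sup>2 = (1 :: rat)" "((-1) ^ k)\<^sup>2 = (1 :: rat)"
    by (simp_all flip: power_mult)
  have square_power: "2 ^ (2 * k) = ((2 ^ k)\<^sup>2 :: rat)" "((2 ^ k)\<^sup>2) ^ n = (((2 ^ k) ^ n)\<^sup>2 :: rat)"
    by (simp_all add: mult_ac flip: power_mult)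
  show ?thesis
    unfolding ho_mersenne_eq ho_jacobsthal_def ho_jacobsthal_lucas_def diff_squares square_sign
      square_power ..
qed

theorem theorem2p15:
  fixes k n :: nat
  assumes "k > 0"
  shows "(even n \<longrightarrow>
            (even k \<longrightarrow> ho_mersenne k n = ho_jacobsthal k n) \<and>
            (odd k \<longrightarrow> ho_mersenne k n = ((2 ^ k + 1) / (2 ^ k - 1)) * ho_jacobsthal k n))
       \<and> (odd n \<longrightarrow>
            (even k \<longrightarrow> ho_mersenne k n = ho_jacobsthal k n) \<and>
            (odd k \<longrightarrow> ho_mersenne k n = ho_jacobsthal_lucas k n))
       \<and> ho_mersenne (2 * k) n = ho_jacobsthal k n * ho_jacobsthal_lucas k n"
proof -
  \<comment> \<open>For odd k and even n, this is the denominator of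
    \<open>ho_jacobsthal k n\<close>, to be cancelled against the numerator of the
    prefactor.\<close>
  have "(2 :: rat) ^ k + 1 \<noteq> 0"
    by (metis add_pos_pos less_irrefl zero_less_numeral zero_less_one zero_less_power)
  then show ?thesis
    by (simp add: ho_mersenne_double)
      (simp add: ho_mersenne_eq ho_jacobsthal_def ho_jacobsthal_lucas_def)
qed

end
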